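(* Let $n$ be a positive integer and let $G\subset\{1,2,\dots,n\}^2$. Then $G$ is a minimal generating subset if and only if the directed graph $\Gamma$ associated with $G$ is minimal strongly connected.
   Context: $\mathrm{Mat}(n,\mathbb{C})$ is the algebra of complex $n\times n$ matrices, and $E_{km}$ denotes the $n\times n$ matrix unit with entry $1$ at position $(k,m)$ and $0$ elsewhere. A subset $G\subset\{1,\dots,n\}^2$ is called generating if the set of matrices $\{E_{km}\mid (k,m)\in G\}$ generates $\mathrm{Mat}(n,\mathbb{C})$ as an (associative) algebra; it is minimal generating if it is generating and no proper subset of it is generating. The directed graph $\Gamma$ associated with $G$ has vertex set $\{1,\dots,n\}$ and an edge from $k$ to $m$ exactly when $(k,m)\in G$ (loops are allowed). A directed graph is strongly connected if there is a directed path from any vertex to any other; it is minimal strongly connected if it is strongly connected and removing any edge destroys this property. *)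

theory Defs
  imports
    "Jordan_Normal_Form.Matrix"
    "HOL-Algebra.Embedded_Algebras"
    "Graph_Theory.Graph_Theory"
begin

section \<open>Generating sets of matrix units\<close>

text \<open>
  Matrix entries are indexed from 0, whereas the positions \<open>(k, m)\<close> range over
  \<open>{1..n} \<times> {1..n}\<close>; hence the shift by one.
\<close>

definition matrix_unit :: "nat \<Rightarrow> nat \<Rightarrow> nat \<Rightarrow> complex mat" where
  "matrix_unit n k m = mat n n (\<lambda>(i, j). if Suc i = k \<and> Suc j = m then 1 else 0)"

abbreviation Mat_ring :: "nat \<Rightarrow> complex mat ring" where
  "Mat_ring n \<equiv> ring_mat TYPE(complex) n ()"

definition scalar_mats :: "nat \<Rightarrow> complex mat set" where
  "scalar_mats n = range (\<lambda>c. c \<cdot>\<^sub>m 1\<^sub>m n)"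

text \<open>
  The library predicate \<^const>\<open>subalgebra\<close> takes the field of scalars as a subset of the
  ring, here the scalar matrices, and requires only a linear subspace; closure under products
  and membership of the unit come from \<^const>\<open>subring\<close>. That algebras are unital matters only
  for \<open>n = 1\<close>, where the empty set generates the algebra.
\<close>

definition generated_algebra :: "nat \<Rightarrow> complex mat set \<Rightarrow> complex mat set" where
  "generated_algebra n S =
     \<Inter>{A. subring A (Mat_ring n) \<and> subalgebra (scalar_mats n) A (Mat_ring n) \<and> S \<subseteq> A}"

definition generating :: "nat \<Rightarrow> (nat \<times> nat) set \<Rightarrow> bool" where
  "generating n G \<longleftrightarrow>
     generated_algebra n {matrix_unit n k m | k m. (k, m) \<in> G} = carrier_mat n n"

definition minimal_generating :: "nat \<Rightarrow> (nat \<times> nat) set \<Rightarrow> bool" where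
  "minimal_generating n G \<longleftrightarrow> generating n G \<and> (\<forall>H. H \<subset> G \<longrightarrow> \<not> generating n H)"

lemma unital_subalgebra_iff:
  "subring A (Mat_ring n) \<and> subalgebra (scalar_mats n) A (Mat_ring n) \<longleftrightarrow>
     A \<subseteq> carrier_mat n n \<and> 1\<^sub>m n \<in> A \<and>
     (\<forall>X\<in>A. \<forall>Y\<in>A. X + Y \<in> A) \<and> (\<forall>X\<in>A. \<forall>Y\<in>A. X * Y \<in> A) \<and> (\<forall>c. \<forall>X\<in>A. c \<cdot>\<^sub>m X \<in> A)"
  (is "?L \<longleftrightarrow> ?R")
proof -
  interpret R: ring "Mat_ring n" by (rule ring_mat)
  have sm: "c \<cdot>\<^sub>m 1\<^sub>m n * X = c \<cdot>\<^sub>m X" if "X \<in> carrier_mat n n" for c :: complex and X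
    using that by (metis left_mult_one_mat mult_smult_assoc_mat one_carrier_mat)
  show ?thesis
  proof
    assume L: ?L
    then interpret S: subalgebra "scalar_mats n" A "Mat_ring n" by simp
    interpret T: subring A "Mat_ring n" using L by simp
    have sub: "A \<subseteq> carrier_mat n n" using S.subset by (simp add: ring_mat_simps)
    have smul: "c \<cdot>\<^sub>m X \<in> A" if "X \<in> A" for c X
    proof -
      have "c \<cdot>\<^sub>m 1\<^sub>m n * X \<in> A"
        using S.smult_closed[of "c \<cdot>\<^sub>m 1\<^sub>m n" X] that
        by (auto simp: scalar_mats_def ring_mat_simps)
      then show ?thesis using sm that sub by auto
    qed
    show ?R using sub smul S.m_closed T.submonoid_axioms
      by (auto simp: ring_mat_simps submonoid_def)
  next
    assume ?R
    then have sub: "A \<subseteq> carrier_mat n n" and one: "1\<^sub>m n \<in> A"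
      and add: "\<And>X Y. X \<in> A \<Longrightarrow> Y \<in> A \<Longrightarrow> X + Y \<in> A"
      and mul: "\<And>X Y. X \<in> A \<Longrightarrow> Y \<in> A \<Longrightarrow> X * Y \<in> A"
      and smul: "\<And>c X. X \<in> A \<Longrightarrow> c \<cdot>\<^sub>m X \<in> A" by auto
    have inv: "\<ominus>\<^bsub>Mat_ring n\<^esub> X \<in> A" if "X \<in> A" for X
    proof -
      have X: "X \<in> carrier_mat n n" using that sub by auto
      have "(-1) \<cdot>\<^sub>m X + X = 0\<^sub>m n n" using X by (intro eq_matI) auto
      then have "\<ominus>\<^bsub>Mat_ring n\<^esub> X = (-1) \<cdot>\<^sub>m X"
        using R.minus_equality[of "(-1) \<cdot>\<^sub>m X" X] X by (simp add: ring_mat_simps)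
      then show ?thesis using smul[OF that] by simp
    qed
    have "subgroup A (add_monoid (Mat_ring n))"
      using sub one add inv by (intro R.add.subgroupI) (auto simp: ring_mat_simps a_inv_def)
    then show ?L using one mul smul sub sm
      by (auto simp: subring_def submonoid_def subalgebra_def subalgebra_axioms_def ring_mat_simps scalar_mats_def subset_iff)
  qed
qed

section \<open>Minimal strongly connected digraphs\<close>

definition assoc_digraph :: "nat \<Rightarrow> (nat \<times> nat) set \<Rightarrow> nat pair_pre_digraph" where
  "assoc_digraph n G = \<lparr> pverts = {1..n}, parcs = G \<rparr>"

definition minimal_strongly_connected :: "('a, 'b) pre_digraph \<Rightarrow> bool" where
  "minimal_strongly_connected D \<longleftrightarrow>
     strongly_connected D \<and> (\<forall>e \<in> arcs D. \<not> strongly_connected (pre_digraph.del_arc D e))"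

end

theory Submission
  imports Defs
begin

text \<open>
  The matrices supported on a reflexive and transitive relation form a unital algebra, which
  confines the algebra generated by the matrix units of \<open>G\<close> to the positions in \<open>G\<^sup>*\<close>.
  Conversely \<open>E\<^bsub>km\<^esub> E\<^bsub>ml\<^esub> = E\<^bsub>kl\<^esub>\<close>, so that the matrix units at the positions in \<open>G\<^sup>+\<close> are
  generated, including the diagonal ones when \<open>n \<ge> 2\<close>, since then every vertex of a strongly
  connected digraph lies on a closed walk. Hence generating and strongly connected are the same
  property, and, as it is monotone in \<open>G\<close>, the two notions of minimality agree as well.
\<close>

lemma matrix_unit_mult:
  assumes "m \<in> {1..n}"
  shows "matrix_unit n k m * matrix_unit n m l = matrix_unit n k l"
proof (rule eq_matI)
  fix i j assume "i < dim_row (matrix_unit n k l)" "j < dim_col (matrix_unit n k l)"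
  then have ij: "i < n" "j < n" by (simp_all add: matrix_unit_def)
  have "(matrix_unit n k m * matrix_unit n m l) $$ (i, j) =
      (\<Sum>r<n. (if Suc i = k \<and> Suc r = m then 1 else 0) * (if Suc r = m \<and> Suc j = l then 1 else 0))"
    using ij by (simp add: matrix_unit_def scalar_prod_def lessThan_atLeast0)
  \<comment> \<open>Only the summand at the 0-based index \<open>m - 1\<close> survives. As
    \<open>m\<close> lies in \<open>{1..n}\<close>, the truncated subtraction is exact and the index
    is below \<open>n\<close>.\<close>
  also have "\<dots> = (\<Sum>r<n. if r = m - 1 then (if Suc i = k \<and> Suc j = l then 1 else 0) else 0)"
    using assms by (intro sum.cong) auto
  also have "\<dots> = matrix_unit n k l $$ (i, j)"
    using assms ij by (auto simp: matrix_unit_def)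
  finally show "(matrix_unit n k m * matrix_unit n m l) $$ (i, j) = matrix_unit n k l $$ (i, j)" .
qed (simp_all add: matrix_unit_def)

text \<open>Trades the library predicates for closure conditions on sets of matrices, the form in
  which candidate algebras are exhibited and used below.\<close>

lemma mem_generated_algebra_iff:
  "X \<in> generated_algebra n S \<longleftrightarrow>
     (\<forall>A. A \<subseteq> carrier_mat n n \<and> 1\<^sub>m n \<in> A \<and>
       (\<forall>X\<in>A. \<forall>Y\<in>A. X + Y \<in> A) \<and> (\<forall>X\<in>A. \<forall>Y\<in>A. X * Y \<in> A) \<and> (\<forall>c. \<forall>X\<in>A. c \<cdot>\<^sub>m X \<in> A) \<and>
       S \<subseteq> A \<longrightarrow> X \<in> A)"
  by (simp only: generated_algebra_def Inter_iff Ball_def mem_Collect_eq conj_assoc[symmetric]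
      unital_subalgebra_iff)

text \<open>Reachability is \<open>rtrancl_on\<close> the vertex set, but edges of \<open>G\<close>
  end in \<open>{1..n}\<close>, so a walk starting there never leaves it. Positivity of
  \<open>n\<close> makes the vertex set nonempty, as \<open>strongly_connected\<close>
  demands.\<close>

lemma strongly_connected_assoc_digraph_iff:
  assumes "n > 0" and G: "G \<subseteq> {1..n} \<times> {1..n}"
  shows "strongly_connected (with_proj (assoc_digraph n G)) \<longleftrightarrow> {1..n} \<times> {1..n} \<subseteq> G\<^sup>*"
proof -
  have "(u, v) \<in> rtrancl_on {1..n} G" if "(u, v) \<in> G\<^sup>*" "u \<in> {1..n}" for u v
    using that
  proof (induction rule: rtrancl_induct)
    case (step y z)
    then show ?case using G by (auto intro: rtrancl_on_into_rtrancl_on)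
  qed simp
  then have "(u, v) \<in> rtrancl_on {1..n} G \<longleftrightarrow> (u, v) \<in> G\<^sup>*" if "u \<in> {1..n}" for u v
    using that rtrancl_on_rtranclI by metis
  then show ?thesis using assms(1)
    by (auto simp: strongly_connected_def assoc_digraph_def reachable_def)
qed

lemma generated_algebra_support:
  assumes X: "X \<in> generated_algebra n {matrix_unit n k m | k m. (k, m) \<in> G}"
    and "i < n" "j < n" "X $$ (i, j) \<noteq> 0"
  shows "(Suc i, Suc j) \<in> G\<^sup>*"
proof -
  \<comment> \<open>The incidence algebra of the preorder \<open>G\<^sup>*\<close>.\<close>
  define A where "A = {X \<in> carrier_mat n n. \<forall>i<n. \<forall>j<n. X $$ (i, j) \<noteq> (0::complex)
    \<longrightarrow> (Suc i, Suc j) \<in> G\<^sup>*}"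
  have "X * Y \<in> A" if X: "X \<in> A" and Y: "Y \<in> A" for X Y
  proof -
    have "(Suc i, Suc j) \<in> G\<^sup>*" if ij: "i < n" "j < n" and "(X * Y) $$ (i, j) \<noteq> 0" for i j
    proof -
      have "(X * Y) $$ (i, j) = (\<Sum>r<n. X $$ (i, r) * Y $$ (r, j))"
        using X Y ij by (auto simp: A_def scalar_prod_def lessThan_atLeast0)
      then have "(\<Sum>r<n. X $$ (i, r) * Y $$ (r, j)) \<noteq> 0" using that by simp
      \<comment> \<open>A nonzero sum has a nonzero term, whose index is the vertex at which two
        walks are joined.\<close>
      then obtain r where "r < n" "X $$ (i, r) * Y $$ (r, j) \<noteq> 0"
        by (auto elim: sum.not_neutral_contains_not_neutral)
      then have "(Suc i, Suc r) \<in> G\<^sup>*" "(Suc r, Suc j) \<in> G\<^sup>*"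
        using X Y ij by (auto simp: A_def)
      then show ?thesis by (rule rtrancl_trans)
    qed
    then show ?thesis using X Y by (auto simp: A_def)
  qed
  moreover have "X + Y \<in> A" if "X \<in> A" "Y \<in> A" for X Y
  proof -
    have "(Suc i, Suc j) \<in> G\<^sup>*" if "i < n" "j < n" "X $$ (i, j) + Y $$ (i, j) \<noteq> 0" for i j
      using that \<open>X \<in> A\<close> \<open>Y \<in> A\<close> by (cases "X $$ (i, j) = 0") (auto simp: A_def)
    then show ?thesis using that by (auto simp: A_def)
  qed
  moreover have "c \<cdot>\<^sub>m X \<in> A" if "X \<in> A" for c X
    using that by (auto simp: A_def)
  moreover have "1\<^sub>m n \<in> A"
    by (auto simp: A_def one_mat_def)
  moreover have "A \<subseteq> carrier_mat n n"
    by (auto simp: A_def)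
  \<comment> \<open>A pair of \<open>G\<close> outside \<open>{1..n} \<times> {1..n}\<close> yields
    the zero matrix, which satisfies the support condition vacuously.\<close>
  moreover have "{matrix_unit n k m | k m. (k, m) \<in> G} \<subseteq> A"
    by (auto simp: A_def matrix_unit_def split: if_splits)
  ultimately have "X \<in> A"
    using spec[OF X[unfolded mem_generated_algebra_iff], of A] by simp
  then show ?thesis using assms by (simp add: A_def)
qed

lemma mem_if_matrix_units_mem:
  assumes add: "\<And>X Y. X \<in> A \<Longrightarrow> Y \<in> A \<Longrightarrow> X + Y \<in> A"
    and smult: "\<And>c X. X \<in> A \<Longrightarrow> c \<cdot>\<^sub>m X \<in> A"
    and one: "1\<^sub>m n \<in> A"
    and units: "\<And>k m. k \<in> {1..n} \<Longrightarrow> m \<in> {1..n} \<Longrightarrow> matrix_unit n k m \<in> A"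
    and X: "X \<in> carrier_mat n n"
  shows "X \<in> A"
proof -
  \<comment> \<open>\<open>X\<close> is rebuilt entry by entry: \<open>S\<close> is the set of
    positions already filled in.\<close>
  have "mat n n (\<lambda>p. if p \<in> S then X $$ p else 0) \<in> A"
    if "finite S" "S \<subseteq> {..<n} \<times> {..<n}" for S
    using that
  proof (induction S rule: finite_induct)
    case empty
    \<comment> \<open>The zero matrix is not among the assumed members of \<open>A\<close>, so it is
      obtained as a multiple of the identity.\<close>
    have "mat n n (\<lambda>p. if p \<in> {} then X $$ p else 0) = 0 \<cdot>\<^sub>m 1\<^sub>m n"
      by (intro eq_matI) auto
    then show ?case using smult one by metis
  next
    case (insert q S)
    obtain k m where q: "q = (k, m)" "k < n" "m < n" using insert.prems by auto
    have "mat n n (\<lambda>p. if p \<in> insert q S then X $$ p else 0) =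
        X $$ q \<cdot>\<^sub>m matrix_unit n (Suc k) (Suc m) + mat n n (\<lambda>p. if p \<in> S then X $$ p else 0)"
      using q insert.hyps by (intro eq_matI) (auto simp: matrix_unit_def)
    moreover have "matrix_unit n (Suc k) (Suc m) \<in> A" using q units by simp
    ultimately show ?case using insert add smult by auto
  qed
  from this[of "{..<n} \<times> {..<n}"]
  have "mat n n (\<lambda>p. if p \<in> {..<n} \<times> {..<n} then X $$ p else 0) \<in> A" by simp
  moreover have "mat n n (\<lambda>p. if p \<in> {..<n} \<times> {..<n} then X $$ p else 0) = X"
    using X by (intro eq_matI) auto
  ultimately show ?thesis by simp
qed

text \<open>Appending an edge to a walk is right multiplication by its matrix unit. The closure is
  not reflexive, since the empty walk is no product of the given units.\<close>

lemma matrix_unit_mem_if_trancl: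
  assumes mult: "\<And>X Y. X \<in> A \<Longrightarrow> Y \<in> A \<Longrightarrow> X * Y \<in> A"
    and units: "\<And>k m. (k, m) \<in> G \<Longrightarrow> matrix_unit n k m \<in> A"
    and G: "G \<subseteq> {1..n} \<times> {1..n}"
    and "(k, m) \<in> G\<^sup>+"
  shows "matrix_unit n k m \<in> A"
  using \<open>(k, m) \<in> G\<^sup>+\<close>
proof (induction rule: trancl_induct)
  case (step y z)
  then have "y \<in> {1..n}" using G by auto
  then show ?case using mult[OF step.IH units[OF step.hyps(2)]] by (simp add: matrix_unit_mult)
qed (rule units)

lemma generating_iff_strongly_connected:
  assumes n: "n > 0" and G: "G \<subseteq> {1..n} \<times> {1..n}"
  shows "generating n G \<longleftrightarrow> strongly_connected (with_proj (assoc_digraph n G))"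
proof -
  let ?S = "{matrix_unit n k m | k m. (k, m) \<in> G}"
  have "generating n G \<longleftrightarrow> {1..n} \<times> {1..n} \<subseteq> G\<^sup>*"
  proof
    assume gen: "generating n G"
    show "{1..n} \<times> {1..n} \<subseteq> G\<^sup>*"
    proof clarify
      fix k m assume km: "k \<in> {1..n}" "m \<in> {1..n}"
      have "matrix_unit n k m \<in> generated_algebra n ?S"
        using gen by (auto simp: generating_def matrix_unit_def)
      then show "(k, m) \<in> G\<^sup>*"
        \<comment> \<open>The 0-based position of the entry 1.\<close>
        using generated_algebra_support[of "matrix_unit n k m" n G "k - 1" "m - 1"] km
        by (auto simp: matrix_unit_def)
    qed
  next
    assume sc: "{1..n} \<times> {1..n} \<subseteq> G\<^sup>*"
    have "X \<in> generated_algebra n ?S" if X: "X \<in> carrier_mat n n" for X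
      unfolding mem_generated_algebra_iff
    proof (intro allI impI, elim conjE)
      fix A assume one: "1\<^sub>m n \<in> A" and S: "?S \<subseteq> A"
        and add: "\<forall>X\<in>A. \<forall>Y\<in>A. X + Y \<in> A"
        and mult: "\<forall>X\<in>A. \<forall>Y\<in>A. X * Y \<in> A"
        and smult: "\<forall>c. \<forall>X\<in>A. c \<cdot>\<^sub>m X \<in> A"
      have units: "matrix_unit n k m \<in> A" if km: "k \<in> {1..n}" "m \<in> {1..n}" for k m
      \<comment> \<open>For \<open>n = 1\<close> there may be no edge at all, so the only matrix
        unit must come from the identity.\<close>
      proof (cases "n = 1")
        case True
        then have "matrix_unit n k m = 1\<^sub>m n"
          using km by (intro eq_matI) (auto simp: matrix_unit_def)
        then show ?thesis using one by simp
      next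
        case False
        have neq: "(u, v) \<in> G\<^sup>+" if "u \<in> {1..n}" "v \<in> {1..n}" "u \<noteq> v" for u v
          using that sc by (auto simp: rtrancl_eq_or_trancl subset_iff)
        have "(k, m) \<in> G\<^sup>+"
        proof (cases "k = m")
          case True
          \<comment> \<open>Any second vertex: going from \<open>k\<close> to \<open>l\<close> and
            back is a closed walk of positive length.\<close>
          define l where "l = (if k = 1 then 2 else 1 :: nat)"
          have "l \<in> {1..n}" "l \<noteq> k" using n False by (auto simp: l_def)
          then show ?thesis using neq[of k l] neq[of l k] km True by auto
        qed (use neq km in auto)
        then show ?thesis
          using mult S G by (intro matrix_unit_mem_if_trancl[of A G n k m]) blast+
      qed
      show "X \<in> A"
        using add smult by (intro mem_if_matrix_units_mem[OF _ _ one units X]) auto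
    qed
    moreover have "X \<in> carrier_mat n n" if "X \<in> generated_algebra n ?S" for X
    proof -
      have "?S \<subseteq> carrier_mat n n" by (auto simp: matrix_unit_def)
      then show ?thesis
        using spec[OF that[unfolded mem_generated_algebra_iff], of "carrier_mat n n"] by simp
    qed
    ultimately show "generating n G" by (auto simp: generating_def)
  qed
  then show ?thesis using strongly_connected_assoc_digraph_iff[OF assms] by simp
qed

lemma del_arc_assoc_digraph:
  "pre_digraph.del_arc (with_proj (assoc_digraph n G)) e = with_proj (assoc_digraph n (G - {e}))"
  by (simp add: pre_digraph.del_arc_def with_proj_def assoc_digraph_def)

theorem lemma12:
  fixes n :: nat and G :: "(nat \<times> nat) set"
  assumes "n > 0"
    and "G \<subseteq> {1..n} \<times> {1..n}"
  shows "minimal_generating n G \<longleftrightarrow>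
         minimal_strongly_connected (with_proj (assoc_digraph n G))"
proof -
  have gen: "generating n H \<longleftrightarrow> strongly_connected (with_proj (assoc_digraph n H))"
    if "H \<subseteq> G" for H
    using that assms by (intro generating_iff_strongly_connected) auto
  have mono: "generating n H'" if "generating n H" "H \<subseteq> H'" "H' \<subseteq> G" for H H'
  proof -
    have "H\<^sup>* \<subseteq> H'\<^sup>*" using that(2) by (rule rtrancl_mono)
    then show ?thesis
      using that gen[of H] gen[of H'] assms
        strongly_connected_assoc_digraph_iff[of n H] strongly_connected_assoc_digraph_iff[of n H']
      by (meson order_trans)
  qed
  \<comment> \<open>By monotonicity only the maximal proper subsets matter: a proper subset
    \<open>H\<close> misses some \<open>e\<close>, hence lies in \<open>G - {e}\<close>, which
    generates if \<open>H\<close> does.\<close>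
  have "(\<forall>H. H \<subset> G \<longrightarrow> \<not> generating n H) \<longleftrightarrow> (\<forall>e\<in>G. \<not> generating n (G - {e}))"
  proof (intro iffI ballI allI impI notI)
    fix H assume min: "\<forall>e\<in>G. \<not> generating n (G - {e})" and H: "H \<subset> G" "generating n H"
    then obtain e where "e \<in> G" "e \<notin> H" by auto
    then show False using mono[of H "G - {e}"] min H by auto
  qed auto
  moreover have "generating n (G - {e}) \<longleftrightarrow>
      strongly_connected (pre_digraph.del_arc (with_proj (assoc_digraph n G)) e)" for e
    using gen[of "G - {e}"] by (simp add: del_arc_assoc_digraph)
  moreover have "arcs (with_proj (assoc_digraph n G)) = G"
    by (simp add: assoc_digraph_def)
  ultimately show ?thesis
    using gen[of G] by (simp add: minimal_generating_def minimal_strongly_connected_def)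
qed

end
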